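(* Let $(\mathcal{X},\mathcal{D})$ be a complete metric space and let $f:\mathcal{X}\to\mathcal{X}$ be a self map such that $\mathcal{D}_f(x)<\infty$ for every $x\in\mathcal{X}$. Suppose that $f$ is a generalized contraction of type (I), i.e. there exist $\phi\in\Phi$ and real numbers $\alpha,\beta,\gamma>0$ with $\lambda=\alpha+\beta+\gamma<1$ such that $$\mathcal{D}(fx,fy)\leq \big(\phi(\mathcal{D}_{f}(x))\big)^{\alpha}\,\big(\phi(\mathcal{D}_{f}(y))\big)^{\beta}\,\big(\phi(\mathcal{D}_{f}(x,y))\big)^{\gamma}\,\big(\phi(M_{f}(x,y))\big)^{1-\lambda}$$ for all $x,y\in\mathcal{X}\setminus \mathrm{Fix}(f)$. Then $f$ has at least one fixed point.
   Context: For a self map $f$ on a metric space $(\mathcal{X},\mathcal{D})$: $\mathrm{Fix}(f)$ is the set of fixed points of $f$; $O_f(x)=\{x,fx,f^2x,\dots\}$ is the set of iterates of $f$ at $x$; $\mathcal{D}_f(x)=\sup\{\mathcal{D}(u,v):u,v\in O_f(x)\}$; $\mathcal{D}_f(x,y)=\sup\{\mathcal{D}(u,v):u,v\in O_f(x)\cup O_f(y)\}$; $M_f(x,y)=\frac{\mathcal{D}_f(x)+\mathcal{D}_f(y)}{2}$. It is assumed throughout that $\mathcal{D}_f(x)$ is finite for each $x\in\mathcal{X}$. $\Phi$ is the collection of all functions $\phi:[0,\infty)\to[0,\infty)$ such that (1) $\phi(t)<t$ for each $t>0$; and (2) for each $\epsilon>0$ there exists $\mathfrak{d}>0$ such that $\phi(t)\leq\epsilon$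 for every $t\in(\epsilon,\epsilon+\mathfrak{d})$. *)

theory Defs
  imports Complex_Main
begin

definition Fix :: "('a \<Rightarrow> 'a) \<Rightarrow> 'a set" where
  "Fix f = {x. f x = x}"

definition iterates :: "('a \<Rightarrow> 'a) \<Rightarrow> 'a \<Rightarrow> 'a set" where
  "iterates f x = {(f ^^ n) x |n. True}"

definition distances :: "'a::metric_space set \<Rightarrow> real set" where
  "distances A = {dist u v |u v. u \<in> A \<and> v \<in> A}"

text \<open>The suprema below are taken in the reals, so they are meaningful only when the set of
  distances is bounded above. Finiteness of the supremum over a single orbit is therefore expressed
  by \<open>orbitally_bounded\<close>; it entails boundedness for the union of two orbits.\<close>

definition orbitally_bounded :: "('a::metric_space \<Rightarrow> 'a) \<Rightarrow> bool" where
  "orbitally_bounded f \<longleftrightarrow> (\<forall>x. bdd_above (distances (iterates f x)))"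

definition orbit_diam :: "('a::metric_space \<Rightarrow> 'a) \<Rightarrow> 'a \<Rightarrow> real" where
  "orbit_diam f x = Sup (distances (iterates f x))"

definition orbit_diam2 :: "('a::metric_space \<Rightarrow> 'a) \<Rightarrow> 'a \<Rightarrow> 'a \<Rightarrow> real" where
  "orbit_diam2 f x y = Sup (distances (iterates f x \<union> iterates f y))"

definition orbit_mean :: "('a::metric_space \<Rightarrow> 'a) \<Rightarrow> 'a \<Rightarrow> 'a \<Rightarrow> real" where
  "orbit_mean f x y = (orbit_diam f x + orbit_diam f y) / 2"

text \<open>Functions from the nonnegative reals to themselves are represented by functions on all reals
  whose values at negative arguments are unconstrained and never used.\<close>

definition Phi :: "(real \<Rightarrow> real) set" where
  "Phi = {\<phi>. (\<forall>t\<ge>0. \<phi> t \<ge> 0) \<and> (\<forall>t>0. \<phi> t < t) \<and>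
     (\<forall>\<epsilon>>0. \<exists>\<delta>>0. \<forall>t\<in>{\<epsilon><..<\<epsilon> + \<delta>}. \<phi> t \<le> \<epsilon>)}"

text \<open>All bases of \<open>powr\<close> are nonnegative and all exponents positive, so the convention
  \<open>0 powr a = 0\<close> agrees with the usual meaning of the powers.\<close>

definition generalized_contraction_I :: "('a::metric_space \<Rightarrow> 'a) \<Rightarrow> bool" where
  "generalized_contraction_I f \<longleftrightarrow>
     (\<exists>\<phi>\<in>Phi. \<exists>\<alpha> \<beta> \<gamma> :: real.
        \<alpha> > 0 \<and> \<beta> > 0 \<and> \<gamma> > 0 \<and> \<alpha> + \<beta> + \<gamma> < 1 \<and>
        (\<forall>x\<in>UNIV - Fix f. \<forall>y\<in>UNIV - Fix f.
           dist (f x) (f y) \<le>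
             \<phi> (orbit_diam f x) powr \<alpha> * \<phi> (orbit_diam f y) powr \<beta> *
             \<phi> (orbit_diam2 f x y) powr \<gamma> * \<phi> (orbit_mean f x y) powr (1 - (\<alpha> + \<beta> + \<gamma>))))"

end

theory Submission
  imports Defs "HOL-Analysis.Elementary_Metric_Spaces"
begin

text \<open>Suppose that \<open>f\<close> has no fixed point, so that the contraction inequality holds at all pairs of
  points and every orbit has positive diameter. Along an orbit, the diameters \<open>D\<^sub>n\<close> of the tails
  decrease to some \<open>r \<ge> 0\<close>. The exponents in the inequality add up to 1, so its right-hand side is a
  weighted geometric mean of four values of \<open>\<phi>\<close>; for two points of the \<open>n\<close>-th tail the four
  arguments all lie between \<open>r\<close> and \<open>D\<^sub>n\<close>. Hence any bound for \<open>\<phi>\<close> on \<open>[r, D\<^sub>n]\<close> is a bound for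
  \<open>D\<^bsub>n+1\<^esub>\<close> (lemma \<open>orbit_diam_image_le\<close>).

  If \<open>r > 0\<close>, the definition of \<open>\<Phi>\<close> supplies the bound \<open>r\<close> once \<open>D\<^sub>n\<close> is close to \<open>r\<close>. So the
  next diameter equals \<open>r\<close>, and the one after that is at most \<open>\<phi> r < r\<close>, which is absurd. Thus
  \<open>D\<^sub>n\<close> tends to 0 (lemma \<open>orbit_diam_tendsto_0\<close>).

  Now compare the \<open>n\<close>-th iterate of a point \<open>x\<close> with an arbitrary point \<open>z\<close>. The factor coming from
  \<open>D\<^sub>n\<close> tends to 0 because \<open>\<alpha> > 0\<close>, and the other factors stay bounded. So the orbit of \<open>x\<close> converges
  to \<open>f z\<close> for every \<open>z\<close> (lemma \<open>orbit_tendsto_image\<close>). By uniqueness of limits \<open>f\<close> is constant, and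
  its only value is a fixed point, contrary to the assumption.\<close>

section \<open>Orbits and their diameters\<close>

lemma self_in_iterates: "x \<in> iterates f x"
  unfolding iterates_def by (auto intro: exI[of _ 0])

lemma iterates_mono:
  assumes "y \<in> iterates f x"
  shows "iterates f y \<subseteq> iterates f x"
proof -
  obtain m where "y = (f ^^ m) x"
    using assms by (auto simp: iterates_def)
  then have "(f ^^ n) y = (f ^^ (n + m)) x" for n
    by (simp add: funpow_add)
  then show ?thesis
    by (auto simp: iterates_def)
qed

lemma iterates_image: "iterates f (f x) = f ` iterates f x"
  by (auto simp: iterates_def funpow_swap1[symmetric])

lemma image_in_iterates: "f x \<in> iterates f x"
  unfolding iterates_def by (auto intro: exI[of _ 1])

lemma distances_mono: "A \<subseteq> B \<Longrightarrow> distances A \<subseteq> distances B"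
  by (auto simp: distances_def)

lemma bdd_above_distances_iff: "bdd_above (distances A) \<longleftrightarrow> bounded A"
  by (auto simp: distances_def bdd_above_def bounded_two_points)

lemma orbit_bounded: "orbitally_bounded f \<Longrightarrow> bounded (iterates f x)"
  by (simp add: orbitally_bounded_def bdd_above_distances_iff)

lemma Sup_distances_mono:
  assumes "A \<subseteq> B" "A \<noteq> {}" "bounded B"
  shows "Sup (distances A) \<le> Sup (distances B)"
proof (rule cSup_subset_mono)
  show "distances A \<noteq> {}"
    using assms(2) by (auto simp: distances_def)
qed (use assms in \<open>auto simp: bdd_above_distances_iff intro: distances_mono[THEN subsetD]\<close>)

lemma dist_le_orbit_diam:
  assumes "orbitally_bounded f" "u \<in> iterates f x" "v \<in> iterates f x"
  shows "dist u v \<le> orbit_diam f x"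
  unfolding orbit_diam_def using assms
  by (intro cSup_upper) (auto simp: orbitally_bounded_def distances_def)

lemma orbit_diam_le:
  assumes "\<And>u v. u \<in> iterates f x \<Longrightarrow> v \<in> iterates f x \<Longrightarrow> dist u v \<le> c"
  shows "orbit_diam f x \<le> c"
  unfolding orbit_diam_def
proof (rule cSup_least)
  show "distances (iterates f x) \<noteq> {}"
    using self_in_iterates[of x f] by (auto simp: distances_def)
qed (use assms in \<open>auto simp: distances_def\<close>)

lemma orbit_diam_antimono:
  assumes "orbitally_bounded f" "y \<in> iterates f x"
  shows "orbit_diam f y \<le> orbit_diam f x"
  using assms iterates_mono[of y f x] self_in_iterates[of y f]
  unfolding orbit_diam_def by (intro Sup_distances_mono) (auto intro: orbit_bounded)

lemma orbit_diam_pos: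
  assumes "orbitally_bounded f" "x \<notin> Fix f"
  shows "orbit_diam f x > 0"
proof -
  have "dist (f x) x \<le> orbit_diam f x"
    by (intro dist_le_orbit_diam assms image_in_iterates self_in_iterates)
  moreover have "dist (f x) x > 0"
    using assms by (simp add: Fix_def)
  ultimately show ?thesis by linarith
qed

lemma orbit_diam_le_orbit_diam2:
  assumes "orbitally_bounded f"
  shows "orbit_diam f x \<le> orbit_diam2 f x y"
  using assms self_in_iterates[of x f]
  unfolding orbit_diam_def orbit_diam2_def
  by (intro Sup_distances_mono) (auto intro: orbit_bounded)

lemma orbit_diam2_antimono:
  assumes "orbitally_bounded f" "y \<in> iterates f x"
  shows "orbit_diam2 f y z \<le> orbit_diam2 f x z"
  using assms iterates_mono[of y f x] self_in_iterates[of y f]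
  unfolding orbit_diam2_def by (intro Sup_distances_mono) (auto intro: orbit_bounded)

lemma orbit_diam2_le_orbit_diam:
  assumes "orbitally_bounded f" "a \<in> iterates f x" "b \<in> iterates f x"
  shows "orbit_diam2 f a b \<le> orbit_diam f x"
  using assms iterates_mono[of a f x] iterates_mono[of b f x] self_in_iterates[of a f]
  unfolding orbit_diam_def orbit_diam2_def
  by (intro Sup_distances_mono) (auto intro: orbit_bounded)

section \<open>The contraction inequality along an orbit\<close>

lemma weighted_geometric_mean_le:
  fixes p q s t c \<alpha> \<beta> \<gamma> :: real
  assumes "0 \<le> p" "0 \<le> q" "0 \<le> s" "0 \<le> t" "p \<le> c" "q \<le> c" "s \<le> c" "t \<le> c"
    and "\<alpha> > 0" "\<beta> > 0" "\<gamma> > 0" "\<alpha> + \<beta> + \<gamma> < 1"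
  shows "p powr \<alpha> * q powr \<beta> * s powr \<gamma> * t powr (1 - (\<alpha> + \<beta> + \<gamma>)) \<le> c"
proof -
  have "p powr \<alpha> * q powr \<beta> * s powr \<gamma> * t powr (1 - (\<alpha> + \<beta> + \<gamma>))
      \<le> c powr \<alpha> * c powr \<beta> * c powr \<gamma> * c powr (1 - (\<alpha> + \<beta> + \<gamma>))"
    using assms by (intro mult_mono powr_mono2 mult_nonneg_nonneg) auto
  also have "\<dots> = c powr (\<alpha> + \<beta> + \<gamma> + (1 - (\<alpha> + \<beta> + \<gamma>)))"
    by (simp only: powr_add)
  also have "\<dots> = c"
    using assms by simp
  finally show ?thesis .
qed

text \<open>The setting of the proof by contradiction: the inequality is required at all pairs of points,
  as is the case when a generalized contraction has no fixed point.\<close>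

locale fixpoint_free_contraction =
  fixes f :: "'a::metric_space \<Rightarrow> 'a" and \<phi> :: "real \<Rightarrow> real" and \<alpha> \<beta> \<gamma> :: real
  assumes orbitally_bounded: "orbitally_bounded f"
    and Phi: "\<phi> \<in> Phi"
    and exponents: "\<alpha> > 0" "\<beta> > 0" "\<gamma> > 0" "\<alpha> + \<beta> + \<gamma> < 1"
    and no_fixpoint: "Fix f = {}"
    and contraction: "dist (f x) (f y) \<le>
      \<phi> (orbit_diam f x) powr \<alpha> * \<phi> (orbit_diam f y) powr \<beta> *
      \<phi> (orbit_diam2 f x y) powr \<gamma> * \<phi> (orbit_mean f x y) powr (1 - (\<alpha> + \<beta> + \<gamma>))"
begin

lemma diam_pos: "orbit_diam f x > 0"
  using orbit_diam_pos[OF orbitally_bounded] no_fixpoint by simp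

lemma diam2_pos: "orbit_diam2 f x y > 0"
  using diam_pos[of x] orbit_diam_le_orbit_diam2[OF orbitally_bounded, of x y] by linarith

lemma mean_pos: "orbit_mean f x y > 0"
  using diam_pos[of x] diam_pos[of y] by (simp add: orbit_mean_def)

lemma phi_nonneg: "t > 0 \<Longrightarrow> 0 \<le> \<phi> t"
  and phi_less: "t > 0 \<Longrightarrow> \<phi> t < t"
  using Phi by (auto simp: Phi_def)

text \<open>Two points of the orbit of \<open>f x\<close> are images of points \<open>a\<close>, \<open>b\<close> of the orbit of \<open>x\<close>. The orbits
  of \<open>a\<close> and \<open>b\<close> are contained in that of \<open>x\<close>, so all four arguments of \<open>\<phi>\<close> in the inequality
  at \<open>a\<close>, \<open>b\<close> are at most the diameter of the orbit of \<open>x\<close>. They are at least \<open>r\<close> because each of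
  them dominates the smaller of the diameters of these two orbits.\<close>

lemma orbit_diam_image_le:
  assumes lower: "\<And>a. a \<in> iterates f x \<Longrightarrow> r \<le> orbit_diam f a"
    and bound: "\<And>t. 0 < t \<Longrightarrow> r \<le> t \<Longrightarrow> t \<le> orbit_diam f x \<Longrightarrow> \<phi> t \<le> c"
  shows "orbit_diam f (f x) \<le> c"
proof (rule orbit_diam_le)
  fix u v assume "u \<in> iterates f (f x)" "v \<in> iterates f (f x)"
  then obtain a b where ab: "a \<in> iterates f x" "b \<in> iterates f x" and uv: "u = f a" "v = f b"
    by (auto simp: iterates_image)
  have a: "r \<le> orbit_diam f a" "orbit_diam f a \<le> orbit_diam f x"
    and b: "r \<le> orbit_diam f b" "orbit_diam f b \<le> orbit_diam f x"
    using ab lower orbit_diam_antimono[OF orbitally_bounded] by auto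
  have "r \<le> orbit_diam2 f a b" "orbit_diam2 f a b \<le> orbit_diam f x"
    using a orbit_diam_le_orbit_diam2[OF orbitally_bounded, of a b]
      orbit_diam2_le_orbit_diam[OF orbitally_bounded ab] by auto
  moreover have "r \<le> orbit_mean f a b" "orbit_mean f a b \<le> orbit_diam f x"
    using a b by (auto simp: orbit_mean_def)
  ultimately have "\<phi> (orbit_diam f a) powr \<alpha> * \<phi> (orbit_diam f b) powr \<beta> *
      \<phi> (orbit_diam2 f a b) powr \<gamma> * \<phi> (orbit_mean f a b) powr (1 - (\<alpha> + \<beta> + \<gamma>)) \<le> c"
    using a b by (intro weighted_geometric_mean_le phi_nonneg bound exponents
        diam_pos diam2_pos mean_pos)
  then show "dist u v \<le> c"
    using contraction[of a b] uv by simp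
qed

lemma orbit_diam_tendsto_0: "(\<lambda>n. orbit_diam f ((f ^^ n) x)) \<longlonglongrightarrow> 0"
proof -
  define D where "D n = orbit_diam f ((f ^^ n) x)" for n
  have "D (Suc n) \<le> D n" for n
    using orbit_diam_antimono[OF orbitally_bounded image_in_iterates] by (simp add: D_def)
  then have dec: "decseq D"
    by (simp add: decseq_Suc_iff)
  moreover have "D n > 0" for n
    by (simp add: D_def diam_pos)
  ultimately obtain r where lim: "D \<longlonglongrightarrow> r" and r: "\<And>n. r \<le> D n"
    using decseq_convergent[of D 0] by (metis less_imp_le)
  have "r \<ge> 0"
    using lim \<open>\<And>n. D n > 0\<close> by (meson LIMSEQ_le_const less_imp_le)
  have step: "D (Suc n) \<le> c" if "\<And>t. 0 < t \<Longrightarrow> r \<le> t \<Longrightarrow> t \<le> D n \<Longrightarrow> \<phi> t \<le> c" for n c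
  proof -
    have "r \<le> orbit_diam f a" if a: "a \<in> iterates f ((f ^^ n) x)" for a
    proof -
      obtain k where "a = (f ^^ (k + n)) x"
        using a by (auto simp: iterates_def funpow_add)
      then show ?thesis
        using r[of "k + n"] by (simp add: D_def)
    qed
    then show ?thesis
      using orbit_diam_image_le[of "(f ^^ n) x" r c] that by (simp add: D_def)
  qed
  have "r = 0"
  proof (rule ccontr)
    assume "r \<noteq> 0"
    with \<open>r \<ge> 0\<close> have "r > 0" by simp
    then obtain \<delta> where \<delta>: "\<delta> > 0" "\<And>t. r < t \<Longrightarrow> t < r + \<delta> \<Longrightarrow> \<phi> t \<le> r"
      using Phi unfolding Phi_def by (force simp: Ball_def)
    have "eventually (\<lambda>n. D n < r + \<delta>) sequentially"
      using lim \<delta>(1) by (intro order_tendstoD) auto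
    then obtain n where n: "D n < r + \<delta>"
      by (auto simp: eventually_sequentially)
    have "D (Suc n) \<le> r"
    proof (rule step)
      fix t assume t: "0 < t" "r \<le> t" "t \<le> D n"
      show "\<phi> t \<le> r"
        \<comment> \<open>The condition on \<open>\<phi>\<close> near \<open>r\<close> leaves out \<open>r\<close> itself, where \<open>\<phi> r < r\<close> serves instead.\<close>
        using t n \<delta>(2)[of t] phi_less[of t] by (cases "t = r") auto
    qed
    then have "D (Suc (Suc n)) \<le> \<phi> r"
      by (intro step) (metis order_antisym order_trans order_refl)
    with r[of "Suc (Suc n)"] phi_less[OF \<open>r > 0\<close>] show False
      by linarith
  qed
  with lim show ?thesis
    unfolding D_def by simp
qed

text \<open>In the inequality between an iterate of \<open>x\<close> and \<open>z\<close> only the first factor needs to be small.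
  The remaining factors are bounded, since \<open>\<phi> t \<le> t\<close> and the orbits of the iterates of \<open>x\<close> lie
  in the orbit of \<open>x\<close>.\<close>

lemma orbit_tendsto_image: "(\<lambda>n. (f ^^ n) x) \<longlonglongrightarrow> f z"
proof -
  define D where "D n = orbit_diam f ((f ^^ n) x)" for n
  define K where "K = orbit_diam f z powr \<beta> * orbit_diam2 f x z powr \<gamma> *
    orbit_mean f x z powr (1 - (\<alpha> + \<beta> + \<gamma>))"
  have bound: "dist ((f ^^ Suc n) x) (f z) \<le> D n powr \<alpha> * K" for n
  proof -
    let ?y = "(f ^^ n) x"
    have y: "?y \<in> iterates f x"
      by (auto simp: iterates_def)
    have le: "\<phi> s \<le> t" if "0 < s" "s \<le> t" for s t
      using phi_less[OF that(1)] that(2) by linarith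
    have "\<phi> (orbit_diam2 f ?y z) \<le> orbit_diam2 f x z"
      using orbit_diam2_antimono[OF orbitally_bounded y] by (intro le diam2_pos)
    moreover have "\<phi> (orbit_mean f ?y z) \<le> orbit_mean f x z"
      using orbit_diam_antimono[OF orbitally_bounded y]
      by (intro le mean_pos) (simp add: orbit_mean_def)
    moreover have "\<phi> (orbit_diam f ?y) \<le> D n" "\<phi> (orbit_diam f z) \<le> orbit_diam f z"
      by (auto simp: D_def intro!: le diam_pos)
    ultimately have "\<phi> (orbit_diam f ?y) powr \<alpha> * \<phi> (orbit_diam f z) powr \<beta> *
        \<phi> (orbit_diam2 f ?y z) powr \<gamma> * \<phi> (orbit_mean f ?y z) powr (1 - (\<alpha> + \<beta> + \<gamma>))
        \<le> D n powr \<alpha> * orbit_diam f z powr \<beta> * orbit_diam2 f x z powr \<gamma> *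
          orbit_mean f x z powr (1 - (\<alpha> + \<beta> + \<gamma>))"
      using exponents
      by (intro mult_mono powr_mono2 mult_nonneg_nonneg phi_nonneg diam_pos diam2_pos mean_pos) auto
    with contraction[of ?y z] show ?thesis
      by (simp add: K_def mult.assoc)
  qed
  have "(\<lambda>n. D n powr \<alpha>) \<longlonglongrightarrow> 0 powr \<alpha>"
    using orbit_diam_tendsto_0[of x] exponents(1)
    by (intro tendsto_powr2) (auto simp: D_def less_imp_le[OF diam_pos])
  then have "(\<lambda>n. D n powr \<alpha> * K) \<longlonglongrightarrow> 0"
    by (auto intro: tendsto_mult_left_zero)
  then have "(\<lambda>n. dist ((f ^^ Suc n) x) (f z)) \<longlonglongrightarrow> 0"
    by (rule tendsto_sandwich[OF always_eventually always_eventually tendsto_const, rotated 2])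
      (use bound in \<open>simp_all del: funpow.simps\<close>)
  then have "(\<lambda>n. (f ^^ Suc n) x) \<longlonglongrightarrow> f z"
    by (simp only: tendsto_dist_iff[symmetric])
  then show ?thesis
    by (rule LIMSEQ_imp_Suc)
qed

end

section \<open>Existence of a fixed point\<close>

theorem theorem6:
  fixes f :: "'a::complete_space \<Rightarrow> 'a"
  assumes "orbitally_bounded f"
    and "generalized_contraction_I f"
  shows "Fix f \<noteq> {}"
proof
  assume empty: "Fix f = {}"
  obtain \<phi> \<alpha> \<beta> \<gamma> where "fixpoint_free_contraction f \<phi> \<alpha> \<beta> \<gamma>"
    using assms empty unfolding generalized_contraction_I_def fixpoint_free_contraction_def by auto
  then interpret fixpoint_free_contraction f \<phi> \<alpha> \<beta> \<gamma> .
  fix x :: 'a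
  \<comment> \<open>The orbit of any single point has both \<open>f (f x)\<close> and \<open>f x\<close> as limits.\<close>
  have "f (f x) = f x"
    by (rule LIMSEQ_unique[OF orbit_tendsto_image orbit_tendsto_image])
  with empty show False
    by (auto simp: Fix_def)
qed

end
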